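(* Let $X$ be a compact smooth Riemannian manifold isometrically embedded in $\mathbb{R}^d$, let $q,w\in C^3(X)$ be positive, let $\varepsilon>0$ and $k_\varepsilon(x,y)=e^{-|x-y|^2/\varepsilon}$ (that is, $k_\varepsilon(x,y)=h(|x-y|^2/\varepsilon)$ with $h(|x|^2)=e^{-|x|^2}$), and let $d\hat\mu(x)=\frac{q(x)}{w(x)}dx$. Let $b_\varepsilon$ be the bi-stochastic normalization of $k_\varepsilon$ with respect to $d\hat\mu$, and let $\varphi_k$ be an eigenfunction, with eigenvalue $\lambda_k\neq0$, of the operator $B_\varepsilon f(x)=\int_X b_\varepsilon(x,y)f(y)\,d\hat\mu(y)$ on $L^2(X,d\hat\mu)$ (see context). Then $$\nabla\varphi_k(x)=\frac{1}{\lambda_k}\int_X\frac{y-\bar x}{\varepsilon}\,b_\varepsilon(x,y)\,\varphi_k(y)\,d\hat\mu(y),\qquad\text{where}\quad\bar x:=\int_X y\,b_\varepsilon(x,y)\,d\hat\mu(y).$$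
   Context: $dx$ is the Riemannian volume measure on $X$ and $|\cdot|$ is the Euclidean norm on $\mathbb{R}^d$. There is a positive function $\delta\in C^\infty(X)$ such that $b_\varepsilon(x,y)=\frac{k_\varepsilon(x,y)}{\delta(x)\delta(y)}$ is bi-stochastic with respect to $d\hat\mu$, i.e. $\int_X b_\varepsilon(x,y)\,d\hat\mu(y)=\int_X b_\varepsilon(y,x)\,d\hat\mu(y)=1$ for all $x\in X$ (existence follows from a result of Knopp and Sinkhorn). The operator $B_\varepsilon$ is compact and self-adjoint, so $B_\varepsilon f=\sum_{k\ge0}\lambda_k\langle f,\varphi_k\rangle_{L^2(X,d\hat\mu)}\varphi_k$ with eigenvalues $1=\lambda_0>\lambda_1\ge\lambda_2\ge\cdots$ and orthonormal eigenfunctions $\varphi_0,\varphi_1,\varphi_2,\ldots$. $\nabla$ is the gradient in the variable $x$; the formula is of Nyström extension type, i.e. it arises by differentiating $\varphi_k(x)=\frac{1}{\lambda_k}\int_X b_\varepsilon(x,y)\varphi_k(y)\,d\hat\mu(y)$ in $x$.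
   Formalization: The printed formula lacks a factor 2 (it fails on the unit circle with φ = cos); (y−x̄)/ε is replaced by 2(y−x̄)/ε. It is proved as the Euclidean gradient of the Nyström extension, and its tangential projection as the Riemannian gradient of φ. X has dimension at least 1. *)

theory Defs
  imports "HOL-Analysis.Analysis"
begin

section \<open>Differentiability classes on open subsets of normed spaces\<close>

primrec Ck_on :: "nat \<Rightarrow> 'a::real_normed_vector set \<Rightarrow> ('a \<Rightarrow> 'b::real_normed_vector) \<Rightarrow> bool" where
  "Ck_on 0 S f \<longleftrightarrow> continuous_on S f"
| "Ck_on (Suc n) S f \<longleftrightarrow>
     (\<forall>x\<in>S. f differentiable (at x)) \<and> (\<forall>v. Ck_on n S (\<lambda>x. frechet_derivative f (at x) v))"

definition smooth_on :: "'a::real_normed_vector set \<Rightarrow> ('a \<Rightarrow> 'b::real_normed_vector) \<Rightarrow> bool" where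
  "smooth_on S f \<longleftrightarrow> (\<forall>n. Ck_on n S f)"

section \<open>Embedded submanifolds with the induced Riemannian metric\<close>

text \<open>An isometrically embedded compact Riemannian manifold is identified with its image, a compact
  embedded submanifold carrying the metric induced by the Euclidean inner product. Its dimension is
  \<open>CARD('m)\<close>, which the \<open>itself\<close> arguments below fix.\<close>

definition local_param ::
  "(real^'d) set \<Rightarrow> (real^'m) set \<Rightarrow> (real^'m \<Rightarrow> real^'d) \<Rightarrow> bool" where
  "local_param X V \<psi> \<longleftrightarrow>
     open V \<and> smooth_on V \<psi> \<and> (\<forall>u\<in>V. inj (frechet_derivative \<psi> (at u))) \<and>
     openin (top_of_set X) (\<psi> ` V) \<and> (\<exists>\<kappa>. homeomorphism V (\<psi> ` V) \<psi> \<kappa>)"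

definition smooth_submanifold :: "'m::finite itself \<Rightarrow> (real^'d) set \<Rightarrow> bool" where
  "smooth_submanifold T X \<longleftrightarrow>
     (\<forall>p\<in>X. \<exists>(V :: (real^'m) set) \<psi>. local_param X V \<psi> \<and> p \<in> \<psi> ` V)"

definition Ck_manifold :: "'m::finite itself \<Rightarrow> nat \<Rightarrow> (real^'d) set \<Rightarrow> (real^'d \<Rightarrow> real) \<Rightarrow> bool" where
  "Ck_manifold T n X f \<longleftrightarrow>
     (\<forall>(V :: (real^'m) set) \<psi>. local_param X V \<psi> \<longrightarrow> Ck_on n V (f \<circ> \<psi>))"

definition smooth_manifold_fun :: "'m::finite itself \<Rightarrow> (real^'d) set \<Rightarrow> (real^'d \<Rightarrow> real) \<Rightarrow> bool" where
  "smooth_manifold_fun T X f \<longleftrightarrow> (\<forall>n. Ck_manifold T n X f)"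

definition metric_tensor :: "(real^'m \<Rightarrow> real^'d) \<Rightarrow> real^'m \<Rightarrow> real^'m^'m" where
  "metric_tensor \<psi> u =
     (\<chi> i j. frechet_derivative \<psi> (at u) (axis i 1) \<bullet> frechet_derivative \<psi> (at u) (axis j 1))"

text \<open>The Riemannian volume measure, as a measure with space \<open>X\<close>. Since countably many
  parametrizations cover \<open>X\<close>, the values on parametrized pieces determine it uniquely.\<close>

definition riemannian_volume :: "'m::finite itself \<Rightarrow> (real^'d) set \<Rightarrow> (real^'d) measure \<Rightarrow> bool" where
  "riemannian_volume T X M \<longleftrightarrow>
     sets M = sets (restrict_space borel X) \<and>
     (\<forall>(V :: (real^'m) set) \<psi> A. local_param X V \<psi> \<and> A \<in> sets M \<and> A \<subseteq> \<psi> ` V \<longrightarrow>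
        emeasure M A =
          (\<integral>\<^sup>+u\<in>{u\<in>V. \<psi> u \<in> A}. ennreal (sqrt (det (metric_tensor \<psi> u))) \<partial>lborel))"

definition curve_through ::
  "(real^'d) set \<Rightarrow> real^'d \<Rightarrow> real^'d \<Rightarrow> (real \<Rightarrow> real^'d) \<Rightarrow> bool" where
  "curve_through X x v \<gamma> \<longleftrightarrow>
     (\<exists>e>0. smooth_on {-e<..<e} \<gamma> \<and> \<gamma> ` {-e<..<e} \<subseteq> X) \<and>
     \<gamma> 0 = x \<and> (\<gamma> has_vector_derivative v) (at 0)"

definition tangent_space :: "(real^'d) set \<Rightarrow> real^'d \<Rightarrow> (real^'d) set" where
  "tangent_space X x = {v. \<exists>\<gamma>. curve_through X x v \<gamma>}"

text \<open>\<open>G\<close> is the tangent vector with \<open>\<langle>G, v\<rangle> = df(v)\<close> for all tangent vectors \<open>v\<close>.\<close>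

definition riemannian_gradient ::
  "(real^'d) set \<Rightarrow> (real^'d \<Rightarrow> real) \<Rightarrow> real^'d \<Rightarrow> real^'d \<Rightarrow> bool" where
  "riemannian_gradient X f x G \<longleftrightarrow>
     G \<in> tangent_space X x \<and>
     (\<forall>v \<gamma>. curve_through X x v \<gamma> \<longrightarrow> (f \<circ> \<gamma> has_real_derivative G \<bullet> v) (at 0))"

section \<open>Bi-stochastic kernels, eigenfunctions and the extension\<close>

text \<open>Note \<open>\<nabla>\<^sub>x exp (- |x - y|\<^sup>2 / \<epsilon>) = (2 / \<epsilon>) (y - x) exp (- |x - y|\<^sup>2 / \<epsilon>)\<close>: with this
  kernel the gradient formula carries the factor \<open>2 / \<epsilon>\<close> and is false with \<open>1 / \<epsilon>\<close>.\<close>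

definition gauss_kernel :: "real \<Rightarrow> 'a::real_normed_vector \<Rightarrow> 'a \<Rightarrow> real" where
  "gauss_kernel \<epsilon> x y = exp (- (norm (x - y))\<^sup>2 / \<epsilon>)"

definition normalized_kernel :: "('a \<Rightarrow> 'a \<Rightarrow> real) \<Rightarrow> ('a \<Rightarrow> real) \<Rightarrow> 'a \<Rightarrow> 'a \<Rightarrow> real" where
  "normalized_kernel k \<delta> x y = k x y / (\<delta> x * \<delta> y)"

definition bistochastic :: "'a measure \<Rightarrow> ('a \<Rightarrow> 'a \<Rightarrow> real) \<Rightarrow> bool" where
  "bistochastic \<mu> b \<longleftrightarrow>
     (\<forall>x\<in>space \<mu>. (\<integral>y. b x y \<partial>\<mu>) = 1 \<and> (\<integral>y. b y x \<partial>\<mu>) = 1)"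

definition kernel_operator :: "'a measure \<Rightarrow> ('a \<Rightarrow> 'a \<Rightarrow> real) \<Rightarrow> ('a \<Rightarrow> real) \<Rightarrow> 'a \<Rightarrow> real" where
  "kernel_operator \<mu> b f x = (\<integral>y. b x y * f y \<partial>\<mu>)"

text \<open>Elements of \<open>L\<^sup>2\<close> are represented by functions, so the eigenvalue equation and the
  non-triviality of the eigenfunction are understood almost everywhere.\<close>

definition L2_eigenfunction ::
  "'a measure \<Rightarrow> ('a \<Rightarrow> 'a \<Rightarrow> real) \<Rightarrow> real \<Rightarrow> ('a \<Rightarrow> real) \<Rightarrow> bool" where
  "L2_eigenfunction \<mu> b ev \<phi> \<longleftrightarrow>
     \<phi> \<in> borel_measurable \<mu> \<and> integrable \<mu> (\<lambda>x. (\<phi> x)\<^sup>2) \<and> \<not> (AE x in \<mu>. \<phi> x = 0) \<and>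
     (AE x in \<mu>. kernel_operator \<mu> b \<phi> x = ev * \<phi> x)"

text \<open>On \<open>space \<mu>\<close> bi-stochasticity says \<open>\<delta> x = (\<integral>y. k x y / \<delta> y \<partial>\<mu>)\<close>. The right-hand
  side makes sense for every ambient point \<open>x\<close>; it is the only extension of \<open>\<delta>\<close> in the variable
  \<open>x\<close> that keeps \<open>\<integral>y. b x y \<partial>\<mu> = 1\<close> off \<open>space \<mu>\<close>, and so it extends \<open>b x y\<close> in \<open>x\<close>.\<close>

definition extended_kernel ::
  "'a measure \<Rightarrow> ('a \<Rightarrow> 'a \<Rightarrow> real) \<Rightarrow> ('a \<Rightarrow> real) \<Rightarrow> 'a \<Rightarrow> 'a \<Rightarrow> real" where
  "extended_kernel \<mu> k \<delta> x y = k x y / ((\<integral>z. k x z / \<delta> z \<partial>\<mu>) * \<delta> y)"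

definition nystrom_extension ::
  "'a measure \<Rightarrow> ('a \<Rightarrow> 'a \<Rightarrow> real) \<Rightarrow> ('a \<Rightarrow> real) \<Rightarrow> real \<Rightarrow> ('a \<Rightarrow> real) \<Rightarrow> 'a \<Rightarrow> real" where
  "nystrom_extension \<mu> k \<delta> ev \<phi> x = 1 / ev * kernel_operator \<mu> (extended_kernel \<mu> k \<delta>) \<phi> x"

end

theory Submission
  imports Defs
begin

text \<open>Write the extended kernel as \<open>k x y / (D x * \<delta> y)\<close> with \<open>D x = (\<integral>z. k x z / \<delta> z \<partial>\<mu>)\<close>, so the
  extension of \<open>\<phi>\<close> is \<open>N / (ev * D)\<close>, where \<open>N\<close> and \<open>D\<close> are Gaussian integrals and \<open>D = \<delta>\<close> on \<open>X\<close>.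
  Both may be differentiated under the integral sign, as the second-order Taylor remainder of the
  Gaussian is bounded uniformly for \<open>y\<close> in the bounded set \<open>X\<close>; the quotient rule turns the
  gradient of \<open>D\<close> into the centring term \<open>xbar\<close>. Nonempty relatively open sets have positive
  volume, which identifies every continuous representative of \<open>\<phi>\<close> with the extension. Finally, the
  tangent space is the range of the derivative of a parametrization, hence a subspace, and
  projecting onto it does not change inner products with tangent vectors.\<close>

section \<open>Differentiability classes and parametrizations\<close>

lemma Ck_on_imp_continuous_on: "Ck_on n S f \<Longrightarrow> continuous_on S f"
  by (cases n) (auto simp: continuous_at_imp_continuous_on differentiable_imp_continuous_within)

text \<open>Functions that agree on an open set have the same derivative at each of its points, by
  uniqueness of derivatives; the induction then passes to the directional derivatives.\<close>

lemma Ck_on_cong_open: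
  assumes "open S" "Ck_on n S f" "\<And>x. x \<in> S \<Longrightarrow> f x = g x"
  shows "Ck_on n S g"
  using assms(2,3)
proof (induction n arbitrary: f g)
  case 0
  then show ?case using continuous_on_cong by fastforce
next
  case (Suc n)
  have der: "(g has_derivative frechet_derivative f (at x)) (at x)" if "x \<in> S" for x
  proof -
    have "(f has_derivative frechet_derivative f (at x)) (at x)"
      using Suc.prems(1) that frechet_derivative_works by auto
    then show ?thesis
      using has_derivative_transform_within_open[OF _ assms(1) that] Suc.prems(2) by blast
  qed
  have eq: "frechet_derivative f (at x) = frechet_derivative g (at x)" if "x \<in> S" for x
    using der[OF that] frechet_derivative_at by blast
  have "Ck_on n S (\<lambda>x. frechet_derivative g (at x) v)" for v
    using Suc.IH[of "\<lambda>x. frechet_derivative f (at x) v"] Suc.prems(1) eq by simp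
  then show ?case unfolding Ck_on.simps differentiable_def using der by blast
qed

text \<open>Supplies smooth curves with a prescribed velocity. Along a line, the derivative of the
  composition is a directional derivative of \<open>f\<close> in a fixed direction, composed with
  the same line, so the induction hypothesis applies to it.\<close>

lemma Ck_on_compose_line:
  assumes "open V" "Ck_on n V f"
  shows "Ck_on n {t. u + t *\<^sub>R h \<in> V} (\<lambda>t. f (u + t *\<^sub>R h))"
  using assms(2)
proof (induction n arbitrary: f)
  case 0
  then show ?case
    by (auto intro!: continuous_on_compose2[of V f] continuous_intros)
next
  case (Suc n)
  have "open ((\<lambda>t. u + t *\<^sub>R h) -` V)"
    by (intro open_vimage assms continuous_intros)
  then have opn: "open {t. u + t *\<^sub>R h \<in> V}" by (simp add: vimage_def)
  have der: "((\<lambda>t. f (u + t *\<^sub>R h)) has_derivative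
      (\<lambda>s. frechet_derivative f (at (u + t *\<^sub>R h)) (s *\<^sub>R h))) (at t)" if "u + t *\<^sub>R h \<in> V" for t
  proof -
    have f: "(f has_derivative frechet_derivative f (at (u + t *\<^sub>R h))) (at (u + t *\<^sub>R h))"
      using Suc.prems that frechet_derivative_works by auto
    show ?thesis
      by (rule has_derivative_compose[where f = "\<lambda>t. u + t *\<^sub>R h" and f' = "\<lambda>s. s *\<^sub>R h", OF _ f])
        (auto intro!: derivative_eq_intros)
  qed
  have "Ck_on n {t. u + t *\<^sub>R h \<in> V} (\<lambda>t. frechet_derivative f (at (u + t *\<^sub>R h)) (s *\<^sub>R h))" for s
    using Suc.IH[of "\<lambda>x. frechet_derivative f (at x) (s *\<^sub>R h)"] Suc.prems by simp
  then have "Ck_on n {t. u + t *\<^sub>R h \<in> V} (\<lambda>t. frechet_derivative (\<lambda>t. f (u + t *\<^sub>R h)) (at t) s)" for s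
  proof (rule Ck_on_cong_open[OF opn])
    fix t assume "t \<in> {t. u + t *\<^sub>R h \<in> V}"
    then show "frechet_derivative f (at (u + t *\<^sub>R h)) (s *\<^sub>R h)
        = frechet_derivative (\<lambda>t. f (u + t *\<^sub>R h)) (at t) s"
      using frechet_derivative_at[OF der[of t]] by (simp add: fun_eq_iff)
  qed
  then show ?case unfolding Ck_on.simps differentiable_def using der by blast
qed

lemma Ck_on_subset: "Ck_on n T f \<Longrightarrow> S \<subseteq> T \<Longrightarrow> Ck_on n S f"
  by (induction n arbitrary: f) (auto intro: continuous_on_subset)

section \<open>Parametrizations: continuity of chartwise defined functions, and the Gram
  determinant\<close>

lemma smooth_submanifoldE:
  assumes "smooth_submanifold TYPE('m::finite) X" "p \<in> X"
  obtains V :: "(real^'m) set" and \<psi> where "local_param X V \<psi>" "p \<in> \<psi> ` V"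
  using assms unfolding smooth_submanifold_def by blast

lemma local_param_differentiable:
  assumes "local_param X V \<psi>" "u \<in> V"
  shows "\<psi> differentiable (at u)"
proof -
  have "Ck_on (Suc 0) V \<psi>"
    using assms(1) unfolding local_param_def smooth_on_def by simp
  then show ?thesis using assms(2) by simp
qed

text \<open>On the image of a parametrization, \<open>f\<close> is \<open>f \<circ> \<psi>\<close>
  composed with the continuous inverse \<open>\<kappa>\<close>; continuity is local, and such images
  are relatively open and cover \<open>X\<close>.\<close>

lemma Ck_manifold_imp_continuous_on:
  fixes X :: "(real^'d) set"
  assumes "smooth_submanifold TYPE('m::finite) X" "Ck_manifold TYPE('m) n X f"
  shows "continuous_on X f"
  unfolding continuous_on_eq_continuous_within
proof
  fix p assume "p \<in> X"
  then obtain V :: "(real^'m) set" and \<psi> where lp: "local_param X V \<psi>" and p: "p \<in> \<psi> ` V"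
    using smooth_submanifoldE assms(1) by blast
  obtain \<kappa> where \<kappa>: "homeomorphism V (\<psi> ` V) \<psi> \<kappa>"
    using lp unfolding local_param_def by blast
  have "continuous_on V (f \<circ> \<psi>)"
    using assms(2) lp unfolding Ck_manifold_def by (blast intro: Ck_on_imp_continuous_on)
  moreover have "continuous_on (\<psi> ` V) \<kappa>" "\<kappa> ` \<psi> ` V \<subseteq> V"
    using \<kappa> by (auto simp: homeomorphism_def)
  ultimately have "continuous_on (\<psi> ` V) (\<lambda>y. (f \<circ> \<psi>) (\<kappa> y))"
    by (metis continuous_on_compose2)
  moreover have "(f \<circ> \<psi>) (\<kappa> y) = f y" if "y \<in> \<psi> ` V" for y
    using \<kappa> that by (auto simp: homeomorphism_def)
  ultimately have "continuous_on (\<psi> ` V) f"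
    using continuous_on_cong by fastforce
  then have c: "continuous (at p within \<psi> ` V) f"
    using p continuous_on_eq_continuous_within by blast
  \<comment> \<open>The chart image is the trace of an ambient open set on \<open>X\<close>, so
    limits at \<open>p\<close> within the image and within \<open>X\<close> coincide.\<close>
  obtain U where "open U" "\<psi> ` V = X \<inter> U"
    using lp unfolding local_param_def openin_open by blast
  then have "at p within \<psi> ` V = at p within X"
    using p by (intro at_within_nhd[of p U]) auto
  then show "continuous (at p within X) f" using c by simp
qed

text \<open>The segment from the identity to \<open>M\<close> consists of invertible matrices.\<close>

lemma det_pos_if_positive_definite:
  fixes M :: "real^'n^'n"
  assumes "\<And>x. x \<noteq> 0 \<Longrightarrow> x \<bullet> (M *v x) > 0"
  shows "det M > 0"
proof (rule ccontr)
  assume neg: "\<not> det M > 0"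
  define N where "N t = (1 - t) *\<^sub>R mat 1 + t *\<^sub>R M" for t :: real
  have "continuous_on {0..1} (\<lambda>t. det (N t))"
    unfolding det_def N_def by (auto intro!: continuous_intros)
  moreover have "det (N 0) > 0" "det (N 1) \<le> 0" using neg by (simp_all add: N_def)
  ultimately obtain t where t: "0 \<le> t" "t \<le> 1" "det (N t) = 0"
    using IVT2'[of "\<lambda>t. det (N t)" 1 0 0] by auto
  then obtain x where x: "x \<noteq> 0" "N t *v x = 0"
    by (metis invertible_det_nz invertible_left_inverse matrix_left_invertible_ker)
  \<comment> \<open>A convex combination of two positive numbers is positive, whereas
    \<open>x\<close> lies in the kernel of \<open>N t\<close>.\<close>
  have "x \<bullet> (N t *v x) = (1 - t) * (x \<bullet> x) + t * (x \<bullet> (M *v x))"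
    by (simp add: N_def matrix_vector_mult_add_rdistrib scaleR_matrix_vector_assoc[symmetric] inner_add_right)
  moreover have "x \<bullet> x > 0" "x \<bullet> (M *v x) > 0" using x assms by auto
  ultimately show False using x t
    by (smt (verit) inner_zero_right mult_nonneg_nonneg mult_pos_pos)
qed

text \<open>The metric tensor is a Gram matrix: its quadratic form at \<open>x\<close> is the
  squared norm of the derivative applied to \<open>x\<close>, which injectivity keeps positive for
  nonzero \<open>x\<close>.\<close>

lemma det_metric_tensor_pos:
  fixes \<psi> :: "real^'m \<Rightarrow> real^'d"
  assumes "\<psi> differentiable (at u)" "inj (frechet_derivative \<psi> (at u))"
  shows "det (metric_tensor \<psi> u) > 0"
proof (rule det_pos_if_positive_definite)
  fix x :: "real^'m" assume "x \<noteq> 0"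
  define L where "L = frechet_derivative \<psi> (at u)"
  have lin: "linear L" using assms(1) linear_frechet_derivative L_def by blast
  have Lx: "L x = (\<Sum>i\<in>UNIV. x$i *\<^sub>R L (axis i 1))"
  proof -
    have "L x = L (\<Sum>i\<in>UNIV. x$i *\<^sub>R axis i 1)"
      by (subst basis_expansion[of x, symmetric]) (simp add: scalar_mult_eq_scaleR)
    then show ?thesis using lin by (simp add: linear_sum linear_cmul)
  qed
  have "x \<bullet> (metric_tensor \<psi> u *v x) = L x \<bullet> L x"
    unfolding Lx by (simp add: inner_sum_left inner_sum_right) (simp add: inner_vec_def matrix_vector_mult_def metric_tensor_def L_def[symmetric] sum_distrib_left mult_ac)
  moreover have "L x \<noteq> 0"
    using assms(2) lin \<open>x \<noteq> 0\<close> L_def linear_injective_0 by blast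
  ultimately show "x \<bullet> (metric_tensor \<psi> u *v x) > 0" by simp
qed

section \<open>Positivity of the volume\<close>

lemma space_eq_if_sets_restrict_borel:
  "sets M = sets (restrict_space borel X) \<Longrightarrow> space M = X"
  using sets_eq_imp_space_eq[of M "restrict_space borel X"] by (simp add: space_restrict_space)

lemma borel_measurable_continuous_on_space:
  assumes "sets M = sets (restrict_space borel X)" "continuous_on X f"
  shows "f \<in> borel_measurable M"
  using borel_measurable_continuous_on_restrict[OF assms(2)] assms(1) measurable_cong_sets by blast

lemma openin_in_sets:
  assumes "sets M = sets (restrict_space borel X)" "openin (top_of_set X) A"
  shows "A \<in> sets M"
  using assms by (auto simp: openin_open sets_restrict_space)

text \<open>In a chart the volume has the continuous positive density \<open>g\<close>, hence is
  bounded below by a positive multiple of Lebesgue measure on a small ball.\<close>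

lemma riemannian_volume_openin_pos:
  fixes X :: "(real^'d) set"
  assumes "smooth_submanifold TYPE('m::finite) X" "riemannian_volume TYPE('m) X M"
    and A: "openin (top_of_set X) A" "A \<noteq> {}"
  shows "emeasure M A > 0"
proof -
  have sM: "sets M = sets (restrict_space borel X)"
    using assms(2) by (simp add: riemannian_volume_def)
  obtain p where p: "p \<in> A" using A by blast
  then have "p \<in> X" using A openin_imp_subset by blast
  then obtain V :: "(real^'m) set" and \<psi> where lp: "local_param X V \<psi>" and pV: "p \<in> \<psi> ` V"
    using smooth_submanifoldE assms(1) by blast
  \<comment> \<open>The volume formula covers subsets of a single chart image, so \<open>A\<close>
    is cut down to one around \<open>p\<close>.\<close>
  define B where "B = A \<inter> \<psi> ` V"
  have B: "openin (top_of_set X) B"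
    using lp A unfolding B_def local_param_def by blast
  have "open V" and sm: "smooth_on V \<psi>" and inj: "\<forall>u\<in>V. inj (frechet_derivative \<psi> (at u))"
    using lp by (auto simp: local_param_def)
  have \<psi>: "\<forall>u\<in>V. \<psi> differentiable (at u)" "continuous_on V (\<lambda>u. frechet_derivative \<psi> (at u) v)" for v
    using sm[unfolded smooth_on_def, rule_format, of 1] by auto
  then have cont: "continuous_on V \<psi>"
    by (auto simp: continuous_at_imp_continuous_on differentiable_imp_continuous_within)
  define g where "g u = sqrt (det (metric_tensor \<psi> u))" for u
  have g: "continuous_on V g"
    unfolding g_def det_def metric_tensor_def by (auto intro!: continuous_intros \<psi>)
  have gpos: "g u > 0" if "u \<in> V" for u
    using det_metric_tensor_pos that \<psi>(1) inj by (auto simp: g_def)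
  obtain U where U: "open U" "B = X \<inter> U" using B openin_open by blast
  have WU: "{u\<in>V. \<psi> u \<in> B} = V \<inter> \<psi> -` U"
    using lp U unfolding local_param_def by (auto dest: openin_imp_subset)
  obtain u where u: "u \<in> V" "\<psi> u = p" using pV by blast
  \<comment> \<open>Points of \<open>V\<close> that \<open>\<psi>\<close> maps into \<open>B\<close>
    and at which the density exceeds half its value at \<open>u\<close>.\<close>
  define S where "S = (V \<inter> \<psi> -` U) \<inter> (V \<inter> g -` {g u / 2<..})"
  have "open S" unfolding S_def
    using continuous_open_preimage[OF cont \<open>open V\<close> \<open>open U\<close>]
      continuous_open_preimage[OF g \<open>open V\<close> open_greaterThan] by blast
  moreover have "u \<in> S"
    using u gpos[OF u(1)] p U pV unfolding S_def B_def by auto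
  ultimately obtain r where r: "r > 0" "ball u r \<subseteq> S" using open_contains_ball by blast
  have "0 < ennreal (g u / 2) * emeasure lborel (ball u r)"
    using gpos[OF u(1)] content_ball_pos[OF r(1), of u]
    by (auto simp: ennreal_zero_less_mult_iff measure_def zero_less_iff_neq_zero)
  also have "\<dots> = (\<integral>\<^sup>+x\<in>ball u r. ennreal (g u / 2) \<partial>lborel)"
    by (simp add: nn_integral_cmult_indicator)
  also have "\<dots> \<le> (\<integral>\<^sup>+u\<in>{u\<in>V. \<psi> u \<in> B}. ennreal (g u) \<partial>lborel)"
  proof (rule nn_integral_mono)
    fix x
    show "ennreal (g u / 2) * indicator (ball u r) x \<le> ennreal (g x) * indicator {u\<in>V. \<psi> u \<in> B} x"
    proof (cases "x \<in> ball u r")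
      case True
      then have "x \<in> S" using r(2) by blast
      then have "x \<in> {u\<in>V. \<psi> u \<in> B}" "g u / 2 \<le> g x" unfolding WU by (simp_all add: S_def)
      then show ?thesis using True by (simp add: ennreal_leI del: mem_Collect_eq)
    qed simp
  qed
  also have "\<dots> = emeasure M B"
    using assms(2)[unfolded riemannian_volume_def, THEN conjunct2, rule_format, of V \<psi> B]
      lp openin_in_sets[OF sM B] by (simp add: B_def g_def)
  also have "\<dots> \<le> emeasure M A"
    by (rule emeasure_mono) (auto simp: B_def openin_in_sets[OF sM A(1)])
  finally show ?thesis .
qed

text \<open>The set where \<open>f\<close> and \<open>g\<close> differ is relatively open and null,
  hence empty.\<close>

lemma continuous_AE_eq_imp_eq:
  fixes f g :: "'a::topological_space \<Rightarrow> real"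
  assumes "\<And>A. openin (top_of_set X) A \<Longrightarrow> A \<noteq> {} \<Longrightarrow> emeasure M A > 0"
    and "sets M = sets (restrict_space borel X)"
    and "continuous_on X f" "continuous_on X g" "AE x in M. f x = g x" "x \<in> X"
  shows "f x = g x"
proof (rule ccontr)
  define A where "A = X \<inter> (\<lambda>x. f x - g x) -` (- {0})"
  assume "f x \<noteq> g x"
  then have "A \<noteq> {}" using assms(6) by (auto simp: A_def)
  have A: "openin (top_of_set X) A" unfolding A_def
    by (intro continuous_openin_preimage_gen continuous_intros assms)
  have "AE x in M. x \<notin> A"
    using assms(5) by eventually_elim (simp add: A_def)
  then have "A \<in> null_sets M"
    using AE_iff_null_sets[OF openin_in_sets[OF assms(2) A]] by simp
  then show False using assms(1)[OF A] \<open>A \<noteq> {}\<close> by auto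
qed

section \<open>Tangent spaces\<close>

text \<open>For a curve through \<open>\<psi> u\<close>, injectivity of the derivative of \<open>\<psi>\<close> gives
  \<open>\<kappa> (\<gamma> t) - u = O(t)\<close>, so its velocity is a limit of vectors in the range, which is closed.\<close>

lemma tangent_space_eq_range:
  fixes \<psi> :: "real^'m \<Rightarrow> real^'d"
  assumes lp: "local_param X V \<psi>" and u: "u \<in> V"
  shows "tangent_space X (\<psi> u) = range (frechet_derivative \<psi> (at u))"
proof -
  define D where "D = frechet_derivative \<psi> (at u)"
  have "open V" and sm: "smooth_on V \<psi>" and inj: "inj D"
    using lp u by (auto simp: local_param_def D_def)
  have D: "(\<psi> has_derivative D) (at u)"
    using local_param_differentiable[OF lp u] D_def frechet_derivative_works by auto
  then have lin: "linear D" by (rule has_derivative_linear)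
  obtain U where U: "open U" "\<psi> ` V = X \<inter> U"
    using lp unfolding local_param_def openin_open by blast
  show ?thesis unfolding D_def[symmetric]
  proof (intro equalityI subsetI)
    fix v assume "v \<in> range D"
    then obtain h where h: "v = D h" by blast
    define S where "S = {t::real. u + t *\<^sub>R h \<in> V}"
    have "open ((\<lambda>t. u + t *\<^sub>R h) -` V)"
      by (intro open_vimage \<open>open V\<close> continuous_intros)
    then have "open S" by (simp add: vimage_def S_def)
    moreover have "0 \<in> S" using u by (simp add: S_def)
    ultimately obtain e where e: "e > 0" "ball 0 e \<subseteq> S" using open_contains_ball by blast
    have sub: "{-e<..<e} \<subseteq> S" using e(2) by (auto simp: subset_iff dist_real_def)
    \<comment> \<open>The witness is the image under \<open>\<psi>\<close> of a straight segment
      through \<open>u\<close> in direction \<open>h\<close>.\<close>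
    define \<gamma> where "\<gamma> t = \<psi> (u + t *\<^sub>R h)" for t
    have "smooth_on {-e<..<e} \<gamma>" unfolding smooth_on_def
    proof
      fix n
      have "Ck_on n V \<psi>" using sm smooth_on_def by blast
      then show "Ck_on n {-e<..<e} \<gamma>"
        unfolding \<gamma>_def using Ck_on_compose_line[OF \<open>open V\<close>] Ck_on_subset sub S_def by blast
    qed
    moreover have "\<gamma> ` {-e<..<e} \<subseteq> X" using sub U by (auto simp: S_def \<gamma>_def)
    moreover have "(\<gamma> has_vector_derivative v) (at 0)"
    proof -
      have "(\<psi> has_derivative D) (at (u + 0 *\<^sub>R h))" using D by simp
      then have "(\<gamma> has_derivative (\<lambda>s. D (s *\<^sub>R h))) (at 0)" unfolding \<gamma>_def
        by (rule has_derivative_compose[where f = "\<lambda>t. u + t *\<^sub>R h" and f' = "\<lambda>s. s *\<^sub>R h", rotated])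
          (auto intro!: derivative_eq_intros)
      then show ?thesis by (simp add: has_vector_derivative_def linear_cmul[OF lin] h)
    qed
    ultimately have "curve_through X (\<psi> u) v \<gamma>"
      unfolding curve_through_def using e(1) by (auto simp: \<gamma>_def)
    then show "v \<in> tangent_space X (\<psi> u)" unfolding tangent_space_def by blast
  next
    fix v assume "v \<in> tangent_space X (\<psi> u)"
    then obtain \<gamma> e where e: "e > 0" "\<gamma> ` {-e<..<e} \<subseteq> X" and \<gamma>0: "\<gamma> 0 = \<psi> u"
      and \<gamma>: "(\<gamma> has_vector_derivative v) (at 0)"
      unfolding tangent_space_def curve_through_def by blast
    obtain \<kappa> where \<kappa>: "homeomorphism V (\<psi> ` V) \<psi> \<kappa>"
      using lp unfolding local_param_def by blast
    obtain m where m: "m > 0" "\<And>h. m * norm h \<le> norm (D h)"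
      using linear_inj_bounded_below_pos[OF lin inj] by blast
    have \<gamma>t: "(\<gamma> \<longlongrightarrow> \<psi> u) (at 0)"
      using has_vector_derivative_continuous[OF \<gamma>] \<gamma>0 by (simp add: isCont_def)
    have inX: "\<forall>\<^sub>F t in at 0. \<gamma> t \<in> X"
      using e by (intro eventually_at_in_open'[of "{-e<..<e}", THEN eventually_mono]) auto
    have "\<forall>\<^sub>F t in at 0. \<gamma> t \<in> U"
      by (rule topological_tendstoD[OF \<gamma>t U(1)]) (use u U in blast)
    with inX have inV: "\<forall>\<^sub>F t in at 0. \<gamma> t \<in> \<psi> ` V"
      by eventually_elim (use U in blast)
    have ct: "((\<lambda>t. \<kappa> (\<gamma> t)) \<longlongrightarrow> u) (at 0)"
      using continuous_on_tendsto_compose[of "\<psi> ` V" \<kappa> \<gamma> "\<psi> u" "at 0"] \<kappa> u \<gamma>t inV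
      by (auto simp: homeomorphism_def)
    have "\<exists>z\<in>range D. dist z v < \<eta>" if "\<eta> > 0" for \<eta>
    proof -
      \<comment> \<open>\<open>B\<close> will bound the norm of
        \<open>\<kappa> (\<gamma> t) - u\<close> relative to the absolute value of \<open>t\<close>:
        the increment of \<open>\<gamma>\<close> contributes \<open>norm v + 1\<close>, and
        inverting the lower bound \<open>m\<close>, after losing half of it to the error of
        \<open>\<psi>\<close>, contributes \<open>2 / m\<close>.\<close>
      define B where "B = (norm v + 1) * (2 / m)"
      have B: "B > 0" using m(1) by (simp add: B_def add_nonneg_pos)
      \<comment> \<open>The first entry lets the linearization error of \<open>\<psi>\<close> be
        absorbed into the lower bound \<open>m\<close>; the second keeps its final contribution
        within \<open>\<eta> / 2\<close>.\<close>
      define \<theta> where "\<theta> = min (m / 2) (\<eta> / (2 * B))"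
      have \<theta>: "\<theta> > 0" "\<theta> \<le> m / 2" "\<theta> * B \<le> \<eta> / 2"
        using m(1) B that by (auto simp: \<theta>_def min_def field_simps)
      obtain d where d: "d > 0"
        "\<And>y. norm (y - u) < d \<Longrightarrow> norm (\<psi> y - \<psi> u - D (y - u)) \<le> \<theta> * norm (y - u)"
        using D \<theta>(1) unfolding has_derivative_at_alt by blast
      have near: "\<forall>\<^sub>F t in at 0. norm (\<kappa> (\<gamma> t) - u) < d"
        using ct d(1) by (simp add: tendsto_iff dist_norm)
      \<comment> \<open>Bounding by 1 gives the summand 1 in \<open>B\<close>; bounding by
        \<open>\<eta> / 4\<close> makes the total error at most three quarters of
        \<open>\<eta>\<close>, per unit of \<open>t\<close>.\<close>
      define \<zeta> where "\<zeta> = min 1 (\<eta> / 4)"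
      have \<zeta>: "\<zeta> > 0" "\<zeta> \<le> 1" "\<zeta> \<le> \<eta> / 4" using that by (auto simp: \<zeta>_def)
      obtain d' where d': "d' > 0"
        "\<And>t. norm (t - 0) < d' \<Longrightarrow> norm (\<gamma> t - \<gamma> 0 - (t - 0) *\<^sub>R v) \<le> \<zeta> * norm (t - 0)"
        using \<gamma> \<zeta>(1) unfolding has_vector_derivative_def has_derivative_at_alt by blast
      have "\<forall>\<^sub>F t in at 0. t \<noteq> (0::real) \<and> norm t < d'"
        using d'(1) by (auto simp: eventually_at dist_norm)
      with near inV have "\<forall>\<^sub>F t in at 0. t \<noteq> 0 \<and> norm t < d' \<and> norm (\<kappa> (\<gamma> t) - u) < d \<and> \<gamma> t \<in> \<psi> ` V"
        by eventually_elim auto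
      then obtain t where t: "t \<noteq> 0" "norm t < d'" "norm (\<kappa> (\<gamma> t) - u) < d" "\<gamma> t \<in> \<psi> ` V"
        using eventually_happens'[OF trivial_limit_at] by blast
      define h where "h = \<kappa> (\<gamma> t) - u"
      have "\<psi> (\<kappa> (\<gamma> t)) = \<gamma> t" using \<kappa> t(4) by (auto simp: homeomorphism_def)
      then have 1: "norm (\<gamma> t - \<psi> u - D h) \<le> \<theta> * norm h"
        using d(2)[OF t(3)] by (simp add: h_def)
      have 2: "norm (\<gamma> t - \<psi> u - t *\<^sub>R v) \<le> \<zeta> * \<bar>t\<bar>"
        using d'(2)[of t] t(2) \<gamma>0 by simp
      have "norm (\<gamma> t - \<psi> u) \<le> \<bar>t\<bar> * norm v + \<zeta> * \<bar>t\<bar>"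
        using 2 norm_triangle_ineq[of "\<gamma> t - \<psi> u - t *\<^sub>R v" "t *\<^sub>R v"] by simp
      also have "\<dots> \<le> \<bar>t\<bar> * (norm v + 1)"
        using \<zeta>(1,2) by (simp add: algebra_simps mult_left_le_one_le)
      finally have 3: "norm (\<gamma> t - \<psi> u) \<le> \<bar>t\<bar> * (norm v + 1)" .
      \<comment> \<open>Absorption: the error term on the right is at most half of the left-hand
        side, so it can be subtracted.\<close>
      have "m * norm h \<le> norm (\<gamma> t - \<psi> u) + \<theta> * norm h"
        using m(2)[of h] 1 norm_triangle_ineq3[of "D h" "\<gamma> t - \<psi> u"] by (simp add: norm_minus_commute)
      also have "\<dots> \<le> norm (\<gamma> t - \<psi> u) + m / 2 * norm h"
        using \<theta>(2) by (intro add_left_mono mult_right_mono) auto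
      finally have "norm h \<le> 2 / m * norm (\<gamma> t - \<psi> u)"
        using m(1) by (simp add: field_simps)
      also have "\<dots> \<le> 2 / m * (\<bar>t\<bar> * (norm v + 1))"
        using 3 m(1) by (intro mult_left_mono) auto
      finally have hB: "norm h \<le> B * \<bar>t\<bar>" by (simp add: B_def mult_ac)
      have "norm (D h - t *\<^sub>R v) \<le> \<theta> * norm h + \<zeta> * \<bar>t\<bar>"
        using 1 2 norm_triangle_ineq4[of "\<gamma> t - \<psi> u - t *\<^sub>R v" "\<gamma> t - \<psi> u - D h"] by simp
      also have "\<dots> \<le> \<theta> * (B * \<bar>t\<bar>) + \<eta> / 4 * \<bar>t\<bar>"
        using hB \<theta>(1) \<zeta>(3) by (intro add_mono mult_left_mono mult_right_mono) auto
      also have "\<dots> \<le> (\<eta> / 2) * \<bar>t\<bar> + \<eta> / 4 * \<bar>t\<bar>"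
        using mult_right_mono[OF \<theta>(3), of "\<bar>t\<bar>"] by (simp add: mult_ac)
      also have "\<dots> < \<eta> * \<bar>t\<bar>" using that t(1) by simp
      finally have "norm (D h - t *\<^sub>R v) < \<eta> * \<bar>t\<bar>" .
      \<comment> \<open>Dividing by \<open>t\<close> turns the displacement estimate into an
        approximation of \<open>v\<close> by an element of the range.\<close>
      moreover have "D ((1 / t) *\<^sub>R h) - v = (1 / t) *\<^sub>R (D h - t *\<^sub>R v)"
        using t(1) by (simp add: linear_cmul[OF lin] scaleR_diff_right)
      ultimately have "dist (D ((1 / t) *\<^sub>R h)) v < \<eta>"
        using t(1) by (simp only: dist_norm norm_scaleR) (simp add: field_simps)
      then show ?thesis by blast
    qed
    then have "v \<in> closure (range D)" by (simp add: closure_approachable)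
    moreover have "closed (range D)"
      by (intro closed_subspace linear_subspace_image lin) simp
    ultimately show "v \<in> range D" by simp
  qed
qed

text \<open>Curves in \<open>X\<close> cannot in general be added within \<open>X\<close>, so
  linearity is read off from the range of the derivative of a parametrization.\<close>

lemma subspace_tangent_space:
  fixes X :: "(real^'d) set"
  assumes "smooth_submanifold TYPE('m::finite) X" "x \<in> X"
  shows "subspace (tangent_space X x)"
proof -
  obtain V :: "(real^'m) set" and \<psi> where lp: "local_param X V \<psi>" and "x \<in> \<psi> ` V"
    using smooth_submanifoldE assms by blast
  then obtain u where u: "u \<in> V" "\<psi> u = x" by blast
  have "subspace (range (frechet_derivative \<psi> (at u)))"
    using local_param_differentiable[OF lp u(1)]
    by (rule linear_subspace_image[OF linear_frechet_derivative subspace_UNIV])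
  then show ?thesis
    using tangent_space_eq_range[OF lp u(1)] u(2) by simp
qed

text \<open>The obtuse-angle inequality for the nearest point \<open>p\<close>, applied at both
  \<open>p + v\<close> and \<open>p - v\<close>, forces \<open>a - p\<close> to be orthogonal to
  \<open>v\<close>.\<close>

lemma closest_point_subspace_inner:
  fixes S :: "'a::euclidean_space set"
  assumes "subspace S" "v \<in> S"
  shows "closest_point S a \<bullet> v = a \<bullet> v"
proof -
  define p where "p = closest_point S a"
  have p: "p \<in> S" unfolding p_def
    using assms closed_subspace closest_point_in_set by blast
  have "(a - p) \<bullet> (x - p) \<le> 0" if "x \<in> S" for x
    unfolding p_def using assms(1) that
    by (intro closest_point_dot) (auto simp: subspace_imp_convex closed_subspace)
  from this[of "p + v"] this[of "p - v"] show ?thesis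
    using p assms by (simp add: subspace_add subspace_diff inner_diff_left p_def[symmetric])
qed

section \<open>Differentiating Gaussian integrals\<close>

text \<open>Two uses of \<open>1 + s \<le> exp s\<close>, at \<open>s = b - a\<close> and at
  \<open>s = a - b\<close>: the first makes the remainder nonnegative, the second bounds it by
  \<open>(B - A) * (a - b)\<close>.\<close>

lemma exp_minus_taylor_bound:
  fixes a b :: real
  assumes "a \<ge> 0" "b \<ge> 0"
  shows "\<bar>exp (- a) - exp (- b) + exp (- b) * (a - b)\<bar> \<le> (a - b)\<^sup>2"
proof -
  define A B where "A = exp (- a)" "B = exp (- b)"
  have AB: "0 \<le> A" "A \<le> 1" "0 \<le> B" "B \<le> 1" using assms by (auto simp: A_B_def)
  have 1: "A \<ge> B * (1 + (b - a))"
    using mult_left_mono[OF exp_ge_add_one_self[of "b - a"], of "exp (- b)"]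
    by (simp add: A_B_def exp_add[symmetric])
  have 2: "B \<ge> A * (1 + (a - b))"
    using mult_left_mono[OF exp_ge_add_one_self[of "a - b"], of "exp (- a)"]
    by (simp add: A_B_def exp_add[symmetric])
  have "A - B + B * (a - b) \<le> (B - A) * (a - b)"
    using 2 by (simp add: algebra_simps)
  also have "\<dots> \<le> (a - b)\<^sup>2"
  proof (cases "a \<ge> b")
    case True
    have "(B - A) * (a - b) \<le> (B * (a - b)) * (a - b)"
      using 1 True by (intro mult_right_mono) (auto simp: algebra_simps)
    also have "\<dots> \<le> (a - b)\<^sup>2"
      using AB by (simp add: power2_eq_square mult.assoc mult_left_le_one_le)
    finally show ?thesis .
  next
    case False
    \<comment> \<open>Multiplying by the negative number \<open>a - b\<close> reverses the lower
      bound on \<open>B - A\<close> into the upper bound wanted.\<close>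
    have "(B - A) * (a - b) \<le> (A * (a - b)) * (a - b)"
      using 2 False by (intro mult_right_mono_neg) (auto simp: algebra_simps)
    also have "\<dots> \<le> (a - b)\<^sup>2"
      using AB by (simp add: power2_eq_square mult.assoc mult_left_le_one_le)
    finally show ?thesis .
  qed
  finally have "A - B + B * (a - b) \<le> (a - b)\<^sup>2" .
  moreover have "A - B + B * (a - b) \<ge> 0" using 1 by (simp add: algebra_simps)
  ultimately show ?thesis by (simp add: A_B_def)
qed

text \<open>Two errors add up: the second-order remainder of the exponential, giving the squared
  constant, and the quadratic part of the exponent \<open>a\<close> as a function of
  \<open>h\<close>, giving \<open>1 / \<epsilon>\<close>. The constant is uniform in
  \<open>y\<close> as long as \<open>y\<close> stays within distance \<open>R\<close> of
  \<open>x\<close>.\<close>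

lemma gauss_kernel_taylor_bound:
  fixes x y h :: "'a::real_inner"
  assumes "\<epsilon> > 0" "norm (x - y) \<le> R" "norm h \<le> 1"
  shows "\<bar>gauss_kernel \<epsilon> (x + h) y - gauss_kernel \<epsilon> x y -
      gauss_kernel \<epsilon> x y * (h \<bullet> ((2 / \<epsilon>) *\<^sub>R (y - x)))\<bar>
    \<le> (((2 * R + 1) / \<epsilon>)\<^sup>2 + 1 / \<epsilon>) * (norm h)\<^sup>2"
proof -
  have scale: "(n * K)\<^sup>2 + n\<^sup>2 / \<epsilon> = (K\<^sup>2 + 1 / \<epsilon>) * n\<^sup>2" for n K :: real
    by (simp add: power_mult_distrib algebra_simps)
  define a b where "a = (norm (x + h - y))\<^sup>2 / \<epsilon>" "b = (norm (x - y))\<^sup>2 / \<epsilon>"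
  have ab: "a - b = (2 * (h \<bullet> (x - y)) + (norm h)\<^sup>2) / \<epsilon>"
    unfolding a_b_def power2_norm_eq_inner
    by (simp add: diff_divide_distrib[symmetric] inner_diff_left inner_diff_right inner_add_left inner_add_right inner_commute)
  have "\<bar>2 * (h \<bullet> (x - y)) + (norm h)\<^sup>2\<bar> \<le> 2 * (norm h * norm (x - y)) + norm h * norm h"
    using Cauchy_Schwarz_ineq2[of h "x - y"] zero_le_square[of "norm h"]
    unfolding power2_eq_square by linarith
  \<comment> \<open>Since \<open>norm h\<close> is at most 1, its square is absorbed into a bound
    linear in \<open>norm h\<close>.\<close>
  also have "\<dots> \<le> 2 * (norm h * R) + norm h * 1"
    using assms by (intro add_mono mult_left_mono) auto
  finally have "\<bar>a - b\<bar> \<le> norm h * ((2 * R + 1) / \<epsilon>)"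
    using assms(1) by (simp add: ab field_simps)
  then have 1: "(a - b)\<^sup>2 \<le> (norm h * ((2 * R + 1) / \<epsilon>))\<^sup>2"
    by (metis abs_ge_zero power2_abs power_mono)
  have "b \<ge> 0" "a \<ge> 0" using assms(1) by (auto simp: a_b_def)
  then have 2: "\<bar>exp (- a) - exp (- b) + exp (- b) * (a - b)\<bar> \<le> (a - b)\<^sup>2"
    by (intro exp_minus_taylor_bound)
  have 3: "exp (- b) * ((norm h)\<^sup>2 / \<epsilon>) \<le> (norm h)\<^sup>2 / \<epsilon>" "0 \<le> exp (- b) * ((norm h)\<^sup>2 / \<epsilon>)"
    using assms(1) \<open>b \<ge> 0\<close> by (auto intro!: mult_left_le_one_le simp del: times_divide_eq_right)
  have k: "gauss_kernel \<epsilon> (x + h) y = exp (- a)" "gauss_kernel \<epsilon> x y = exp (- b)"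
    by (simp_all add: gauss_kernel_def a_b_def)
  have e: "h \<bullet> ((2 / \<epsilon>) *\<^sub>R (y - x)) = - (a - b) + (norm h)\<^sup>2 / \<epsilon>"
    by (simp add: ab inner_diff_right add_divide_distrib diff_divide_distrib algebra_simps)
  have "gauss_kernel \<epsilon> (x + h) y - gauss_kernel \<epsilon> x y - gauss_kernel \<epsilon> x y * (h \<bullet> ((2 / \<epsilon>) *\<^sub>R (y - x)))
     = exp (- a) - exp (- b) + exp (- b) * (a - b) - exp (- b) * ((norm h)\<^sup>2 / \<epsilon>)"
    unfolding k e by (simp add: algebra_simps)
  moreover have "\<bar>\<dots>\<bar> \<le> (norm h * ((2 * R + 1) / \<epsilon>))\<^sup>2 + (norm h)\<^sup>2 / \<epsilon>"
    using 1 2 3 by linarith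
  moreover have "(norm h * ((2 * R + 1) / \<epsilon>))\<^sup>2 + (norm h)\<^sup>2 / \<epsilon> = (((2 * R + 1) / \<epsilon>)\<^sup>2 + 1 / \<epsilon>) * (norm h)\<^sup>2"
    by (rule scale)
  ultimately show ?thesis by simp
qed

lemma has_derivative_at_quadratic_bound:
  assumes "bounded_linear L"
    and "\<And>h. norm h \<le> 1 \<Longrightarrow> norm (f (x + h) - f x - L h) \<le> C * (norm h)\<^sup>2"
  shows "(f has_derivative L) (at x)"
  unfolding has_derivative_at_alt
proof (intro conjI allI impI)
  fix e :: real assume "e > 0"
  \<comment> \<open>The 1 keeps \<open>y - x\<close> where the quadratic bound is assumed; adding 1
    to the absolute value of \<open>C\<close> makes the divisor positive whatever the sign of
    \<open>C\<close>.\<close>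
  define d where "d = min 1 (e / (\<bar>C\<bar> + 1))"
  have "d > 0" using \<open>e > 0\<close> by (simp add: d_def)
  moreover have "norm (f y - f x - L (y - x)) \<le> e * norm (y - x)" if "norm (y - x) < d" for y
  proof -
    have "norm (f y - f x - L (y - x)) \<le> C * (norm (y - x))\<^sup>2"
      using assms(2)[of "y - x"] that by (simp add: d_def)
    also have "\<dots> \<le> ((\<bar>C\<bar> + 1) * norm (y - x)) * norm (y - x)"
      by (simp add: power2_eq_square mult.assoc mult_right_mono)
    also have "\<dots> \<le> e * norm (y - x)"
      using that by (intro mult_right_mono) (auto simp: d_def field_simps)
    finally show ?thesis .
  qed
  ultimately show "\<exists>d>0. \<forall>y. norm (y - x) < d \<longrightarrow> norm (f y - f x - L (y - x)) \<le> e * norm (y - x)"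
    by blast
qed (rule assms(1))

lemma gauss_kernel_bounds: "\<epsilon> > 0 \<Longrightarrow> 0 < gauss_kernel \<epsilon> x y" "\<epsilon> > 0 \<Longrightarrow> gauss_kernel \<epsilon> x y \<le> 1"
  by (auto simp: gauss_kernel_def)

lemma borel_measurable_gauss_kernel:
  fixes x :: "'a::euclidean_space"
  assumes "sets M = sets (restrict_space borel X)"
  shows "gauss_kernel \<epsilon> x \<in> borel_measurable M"
  unfolding gauss_kernel_def divide_inverse
  by (intro borel_measurable_continuous_on_space[OF assms] continuous_intros)

lemma integrable_gauss_kernel_mult:
  fixes x :: "'a::euclidean_space"
  assumes "sets M = sets (restrict_space borel X)" "\<epsilon> > 0" "integrable M g"
  shows "integrable M (\<lambda>y. gauss_kernel \<epsilon> x y * g y)"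
proof (rule Bochner_Integration.integrable_bound[OF assms(3)])
  show "(\<lambda>y. gauss_kernel \<epsilon> x y * g y) \<in> borel_measurable M"
    using borel_measurable_gauss_kernel[OF assms(1)] assms(3) by measurable
  show "AE y in M. norm (gauss_kernel \<epsilon> x y * g y) \<le> norm (g y)"
    using gauss_kernel_bounds[OF assms(2), of x] by (auto simp: abs_mult mult_left_le_one_le less_imp_le)
qed

lemma integrable_scaleR_bounded:
  fixes M :: "'a::euclidean_space measure"
  assumes "sets M = sets (restrict_space borel X)" "bounded X" "integrable M g"
  shows "integrable M (\<lambda>y. g y *\<^sub>R y)"
proof -
  obtain R where R: "\<And>y. y \<in> X \<Longrightarrow> norm y \<le> R" using assms(2) bounded_iff by blast
  have id: "(\<lambda>y. y) \<in> borel_measurable M"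
    by (intro borel_measurable_continuous_on_space[OF assms(1)] continuous_intros)
  show ?thesis
  proof (rule Bochner_Integration.integrable_bound[OF integrable_mult_right[OF assms(3), of R]])
    show "(\<lambda>y. g y *\<^sub>R y) \<in> borel_measurable M" using id assms(3) by measurable
    show "AE y in M. norm (g y *\<^sub>R y) \<le> norm (R * g y)"
    proof (rule AE_I2)
      fix y assume "y \<in> space M"
      then have "norm y \<le> \<bar>R\<bar>"
        using R[of y] space_eq_if_sets_restrict_borel[OF assms(1)] by simp
      then show "norm (g y *\<^sub>R y) \<le> norm (R * g y)"
        by (simp add: abs_mult mult.commute mult_right_mono)
    qed
  qed
qed

lemma integrable_scaleR_diff_bounded:
  fixes M :: "'a::euclidean_space measure"
  assumes "sets M = sets (restrict_space borel X)" "bounded X" "integrable M g"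
  shows "integrable M (\<lambda>y. g y *\<^sub>R (c *\<^sub>R (y - a)))"
proof -
  have "integrable M (\<lambda>y. (c * g y) *\<^sub>R y - (c * g y) *\<^sub>R a)"
    using integrable_scaleR_bounded[OF assms(1,2), of "\<lambda>y. c * g y"] assms(3) by simp
  then show ?thesis by (simp add: scaleR_diff_right mult.commute)
qed

text \<open>Integrating the uniform Taylor bound against the absolute value of \<open>g\<close>
  leaves a remainder quadratic in \<open>h\<close>, so the integral inherits the derivative.\<close>

lemma GDERIV_integral_gauss_kernel:
  fixes M :: "'a::euclidean_space measure"
  assumes sM: "sets M = sets (restrict_space borel X)" and "bounded X" "\<epsilon> > 0" and g: "integrable M g"
  shows "GDERIV (\<lambda>x. \<integral>y. gauss_kernel \<epsilon> x y * g y \<partial>M) x :>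
    (\<integral>y. (gauss_kernel \<epsilon> x y * g y) *\<^sub>R ((2 / \<epsilon>) *\<^sub>R (y - x)) \<partial>M)"
  unfolding gderiv_def
proof -
  obtain R where R: "\<And>y. y \<in> X \<Longrightarrow> norm (x - y) \<le> R"
    using assms(2) bounded_any_center[of X x] by (auto simp: dist_norm)
  define C where "C = ((2 * R + 1) / \<epsilon>)\<^sup>2 + 1 / \<epsilon>"
  define D where "D y = (gauss_kernel \<epsilon> x y * g y) *\<^sub>R ((2 / \<epsilon>) *\<^sub>R (y - x))" for y
  have kg: "integrable M (\<lambda>y. gauss_kernel \<epsilon> x y * g y)" for x
    by (rule integrable_gauss_kernel_mult[OF sM \<open>\<epsilon> > 0\<close> g])
  have D: "integrable M D" unfolding D_def
    by (rule integrable_scaleR_diff_bounded[OF sM \<open>bounded X\<close> kg])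
  show "((\<lambda>x. \<integral>y. gauss_kernel \<epsilon> x y * g y \<partial>M) has_derivative (\<lambda>h. h \<bullet> (\<integral>y. D y \<partial>M))) (at x)"
  proof (rule has_derivative_at_quadratic_bound)
    show "bounded_linear (\<lambda>h. h \<bullet> (\<integral>y. D y \<partial>M))" by (rule bounded_linear_inner_left)
    fix h :: 'a assume h: "norm h \<le> 1"
    have "(\<integral>y. gauss_kernel \<epsilon> (x + h) y * g y \<partial>M) - (\<integral>y. gauss_kernel \<epsilon> x y * g y \<partial>M) - h \<bullet> (\<integral>y. D y \<partial>M)
      = (\<integral>y. gauss_kernel \<epsilon> (x + h) y * g y - gauss_kernel \<epsilon> x y * g y - h \<bullet> D y \<partial>M)"
      using kg D by simp
    also have "norm \<dots> \<le> (\<integral>y. C * (norm h)\<^sup>2 * \<bar>g y\<bar> \<partial>M)"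
    proof (rule Bochner_Integration.integral_norm_bound_integral)
      show "integrable M (\<lambda>y. gauss_kernel \<epsilon> (x + h) y * g y - gauss_kernel \<epsilon> x y * g y - h \<bullet> D y)"
        using kg D by simp
      show "integrable M (\<lambda>y. C * (norm h)\<^sup>2 * \<bar>g y\<bar>)" using g by simp
      fix y assume "y \<in> space M"
      then have y: "norm (x - y) \<le> R" using R space_eq_if_sets_restrict_borel[OF sM] by simp
      have "gauss_kernel \<epsilon> (x + h) y * g y - gauss_kernel \<epsilon> x y * g y - h \<bullet> D y
        = (gauss_kernel \<epsilon> (x + h) y - gauss_kernel \<epsilon> x y -
            gauss_kernel \<epsilon> x y * (h \<bullet> ((2 / \<epsilon>) *\<^sub>R (y - x)))) * g y"
        by (simp add: D_def algebra_simps)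
      then show "norm (gauss_kernel \<epsilon> (x + h) y * g y - gauss_kernel \<epsilon> x y * g y - h \<bullet> D y)
          \<le> C * (norm h)\<^sup>2 * \<bar>g y\<bar>"
        using gauss_kernel_taylor_bound[OF \<open>\<epsilon> > 0\<close> y h]
        by (simp only: real_norm_def abs_mult C_def) (intro mult_right_mono; simp)
    qed
    also have "\<dots> = C * (\<integral>y. \<bar>g y\<bar> \<partial>M) * (norm h)\<^sup>2" by simp
    finally show "norm ((\<integral>y. gauss_kernel \<epsilon> (x + h) y * g y \<partial>M) - (\<integral>y. gauss_kernel \<epsilon> x y * g y \<partial>M) - h \<bullet> (\<integral>y. D y \<partial>M))
      \<le> C * (\<integral>y. \<bar>g y\<bar> \<partial>M) * (norm h)\<^sup>2" .
  qed
qed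

section \<open>Bi-stochastic Gaussian kernels\<close>

lemma finite_measure_if_integrable_bounded_below:
  fixes f :: "'a \<Rightarrow> real"
  assumes "integrable M f" "c > 0" "\<And>x. x \<in> space M \<Longrightarrow> c \<le> f x"
  shows "finite_measure M"
proof -
  have "integrable M (\<lambda>_. c)"
    using assms by (intro Bochner_Integration.integrable_bound[OF assms(1)]) (auto intro!: AE_I2 order_trans[OF _ abs_ge_self])
  then have "emeasure M (space M) < \<infinity>"
    using assms(2) integrable_iff_bounded[of M "\<lambda>_. c"]
    by (auto simp: ennreal_mult_less_top)
  then show ?thesis by (intro finite_measureI) simp
qed

lemma (in finite_measure) integrable_of_square_integrable:
  fixes f :: "'a \<Rightarrow> real"
  assumes "f \<in> borel_measurable M" "integrable M (\<lambda>x. (f x)\<^sup>2)"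
  shows "integrable M f"
proof (rule Bochner_Integration.integrable_bound)
  show "integrable M (\<lambda>x. 1 + (f x)\<^sup>2)" using assms(2) by simp
  \<comment> \<open>The square of \<open>\<bar>a\<bar> - 1\<close> is nonnegative; on a finite
    measure space the dominating function \<open>1 + (f x)\<^sup>2\<close> is integrable.\<close>
  have "\<bar>a\<bar> \<le> 1 + a\<^sup>2" for a :: real
    using zero_le_power2[of "\<bar>a\<bar> - 1"] by (simp add: power2_diff)
  then show "AE x in M. norm (f x) \<le> norm (1 + (f x)\<^sup>2)" by (simp add: add_nonneg_nonneg)
qed (rule assms(1))

text \<open>The quotient rule with \<open>f x / g x\<close> kept together, since for the Nystrom
  quotient this is the value of an integral against \<open>b\<close>.\<close>

lemma GDERIV_divide:
  fixes f g :: "'a::real_inner \<Rightarrow> real"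
  assumes "GDERIV f x :> df" "GDERIV g x :> dg" "g x \<noteq> 0"
  shows "GDERIV (\<lambda>x. f x / g x) x :> (1 / g x) *\<^sub>R (df - (f x / g x) *\<^sub>R dg)"
proof -
  have "GDERIV (\<lambda>x. f x * inverse (g x)) x :> f x *\<^sub>R (- (inverse (g x))\<^sup>2 *\<^sub>R dg) + inverse (g x) *\<^sub>R df"
    by (rule GDERIV_mult[OF assms(1) GDERIV_inverse[OF assms(2,3)]])
  then show ?thesis
    by (simp add: divide_inverse power2_eq_square algebra_simps)
qed

text \<open>Separates the analysis of the kernel, on a compact set in a Euclidean space, from the
  geometry of the submanifold.\<close>

locale gaussian_bistochastic =
  fixes X :: "'a::euclidean_space set" and \<mu> :: "'a measure" and \<delta> :: "'a \<Rightarrow> real"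
    and \<epsilon> :: real and b :: "'a \<Rightarrow> 'a \<Rightarrow> real"
  assumes compact: "compact X"
    and sets_\<mu>: "sets \<mu> = sets (restrict_space borel X)"
    and \<delta>_continuous: "continuous_on X \<delta>"
    and \<delta>_pos: "x \<in> X \<Longrightarrow> \<delta> x > 0"
    and \<epsilon>_pos: "\<epsilon> > 0"
    and bistochastic: "bistochastic \<mu> b"
    and b_eq: "b = normalized_kernel (gauss_kernel \<epsilon>) \<delta>"
begin

lemma space_\<mu>: "space \<mu> = X"
  by (rule space_eq_if_sets_restrict_borel[OF sets_\<mu>])

lemma b_apply: "b x y = gauss_kernel \<epsilon> x y * inverse (\<delta> y) / \<delta> x"
  by (simp add: b_eq normalized_kernel_def field_simps)

lemma integral_b: "x \<in> X \<Longrightarrow> (\<integral>y. b x y \<partial>\<mu>) = 1"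
  using bistochastic by (simp add: bistochastic_def space_\<mu>)

text \<open>The Bochner integral of a non-integrable function is 0 by convention, whereas this one
  equals 1.\<close>

lemma integrable_b: "x \<in> X \<Longrightarrow> integrable \<mu> (b x)"
  using integral_b[of x] not_integrable_integral_eq[of \<mu> "b x"] by fastforce

text \<open>The reciprocal of a positive continuous function is bounded on the compact set
  \<open>X\<close>.\<close>

lemma integrable_inverse_mult:
  fixes f :: "'a \<Rightarrow> real"
  assumes "integrable \<mu> f"
  shows "integrable \<mu> (\<lambda>y. inverse (\<delta> y) * f y)"
proof -
  have "continuous_on X (\<lambda>y. inverse (\<delta> y))"
    using \<delta>_pos by (intro continuous_intros \<delta>_continuous) (auto simp: less_imp_neq[symmetric])
  then obtain C where C: "\<And>y. y \<in> X \<Longrightarrow> \<bar>inverse (\<delta> y)\<bar> \<le> C"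
    using compact_continuous_image[OF _ compact] compact_imp_bounded
    by (fastforce simp: bounded_iff)
  have [measurable]: "\<delta> \<in> borel_measurable \<mu>"
    by (rule borel_measurable_continuous_on_space[OF sets_\<mu> \<delta>_continuous])
  show ?thesis
  proof (rule Bochner_Integration.integrable_bound[OF integrable_mult_right[OF assms, of C]])
    show "(\<lambda>y. inverse (\<delta> y) * f y) \<in> borel_measurable \<mu>" using assms by measurable
    show "AE y in \<mu>. norm (inverse (\<delta> y) * f y) \<le> norm (C * f y)"
    proof (rule AE_I2)
      fix y assume "y \<in> space \<mu>"
      then have "\<bar>inverse (\<delta> y)\<bar> \<le> \<bar>C\<bar>" using C[of y] by (simp add: space_\<mu>)
      then show "norm (inverse (\<delta> y) * f y) \<le> norm (C * f y)"
        unfolding real_norm_def abs_mult by (rule mult_right_mono) simp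
    qed
  qed
qed

text \<open>Finiteness is extracted from bi-stochasticity: for fixed \<open>x\<close> in
  \<open>X\<close>, \<open>b x\<close> is integrable and, by compactness, bounded below by its
  positive minimum. The empty \<open>X\<close> is treated apart.\<close>

sublocale finite_measure \<mu>
proof (cases "X = {}")
  case True
  then show "finite_measure \<mu>" by (intro finite_measureI) (simp add: space_\<mu>)
next
  case False
  then obtain x where x: "x \<in> X" by blast
  have "continuous_on X (b x)" unfolding b_apply gauss_kernel_def divide_inverse
    using \<delta>_pos by (intro continuous_intros \<delta>_continuous) (auto simp: less_imp_neq[symmetric])
  then obtain z where z: "z \<in> X" "\<And>y. y \<in> X \<Longrightarrow> b x z \<le> b x y"
    using continuous_attains_inf[OF compact False] by blast
  moreover have "b x z > 0"
    using x z(1) \<delta>_pos by (simp add: b_apply gauss_kernel_def)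
  ultimately show "finite_measure \<mu>"
    using finite_measure_if_integrable_bounded_below[OF integrable_b[OF x]] by (simp add: space_\<mu>)
qed

lemma integrable_inverse: "integrable \<mu> (\<lambda>y. inverse (\<delta> y))"
  using integrable_inverse_mult[of "\<lambda>_. 1"] by simp

lemma integral_gauss_kernel: "x \<in> X \<Longrightarrow> (\<integral>z. gauss_kernel \<epsilon> x z * inverse (\<delta> z) \<partial>\<mu>) = \<delta> x"
  using integral_b[of x] \<delta>_pos[of x] by (simp add: b_apply)

lemma extended_kernel_eq: "x \<in> X \<Longrightarrow> extended_kernel \<mu> (gauss_kernel \<epsilon>) \<delta> x = b x"
  by (rule ext) (simp add: extended_kernel_def b_apply integral_gauss_kernel divide_inverse)

text \<open>An identity at every ambient point, with the convention that division by 0 gives 0, so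
  the quotient on the right can be differentiated in the ambient space.\<close>

lemma nystrom_extension_eq:
  "nystrom_extension \<mu> (gauss_kernel \<epsilon>) \<delta> ev \<phi> x = 1 / ev *
    ((\<integral>y. gauss_kernel \<epsilon> x y * (inverse (\<delta> y) * \<phi> y) \<partial>\<mu>) / (\<integral>z. gauss_kernel \<epsilon> x z * inverse (\<delta> z) \<partial>\<mu>))"
proof -
  have "extended_kernel \<mu> (gauss_kernel \<epsilon>) \<delta> x y * \<phi> y =
     gauss_kernel \<epsilon> x y * (inverse (\<delta> y) * \<phi> y) / (\<integral>z. gauss_kernel \<epsilon> x z * inverse (\<delta> z) \<partial>\<mu>)" for y
    by (simp add: extended_kernel_def divide_inverse)
  then show ?thesis by (simp add: nystrom_extension_def kernel_operator_def)
qed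

lemma GDERIV_nystrom_extension:
  assumes \<phi>: "integrable \<mu> \<phi>" and x: "x \<in> X"
  shows "GDERIV (nystrom_extension \<mu> (gauss_kernel \<epsilon>) \<delta> ev \<phi>) x :>
    (1 / ev) *\<^sub>R (\<integral>y. (b x y * \<phi> y) *\<^sub>R ((2 / \<epsilon>) *\<^sub>R (y - (\<integral>z. b x z *\<^sub>R z \<partial>\<mu>))) \<partial>\<mu>)"
proof -
  define N where "N x = (\<integral>y. gauss_kernel \<epsilon> x y * (inverse (\<delta> y) * \<phi> y) \<partial>\<mu>)" for x
  define D where "D x = (\<integral>y. gauss_kernel \<epsilon> x y * inverse (\<delta> y) \<partial>\<mu>)" for x
  define m where "m = (\<integral>z. b x z *\<^sub>R z \<partial>\<mu>)"
  define dN where "dN = (\<integral>y. (gauss_kernel \<epsilon> x y * (inverse (\<delta> y) * \<phi> y)) *\<^sub>R ((2 / \<epsilon>) *\<^sub>R (y - x)) \<partial>\<mu>)"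
  define dD where "dD = (\<integral>y. (gauss_kernel \<epsilon> x y * inverse (\<delta> y)) *\<^sub>R ((2 / \<epsilon>) *\<^sub>R (y - x)) \<partial>\<mu>)"
  note bX = compact_imp_bounded[OF compact]
  have dx: "\<delta> x > 0" "D x = \<delta> x" using \<delta>_pos x by (simp_all add: D_def integral_gauss_kernel)
  have b\<phi>: "b x y * \<phi> y = gauss_kernel \<epsilon> x y * (inverse (\<delta> y) * \<phi> y) / \<delta> x" for y
    by (simp add: b_apply)
  have ib\<phi>: "integrable \<mu> (\<lambda>y. b x y * \<phi> y)" unfolding b\<phi>
    using integrable_gauss_kernel_mult[OF sets_\<mu> \<epsilon>_pos integrable_inverse_mult[OF \<phi>]] by simp
  have Nx: "N x / D x = (\<integral>y. b x y * \<phi> y \<partial>\<mu>)"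
    unfolding b\<phi> by (simp add: N_def dx(2))
  have der: "GDERIV (\<lambda>x. N x / D x) x :> (1 / D x) *\<^sub>R (dN - (N x / D x) *\<^sub>R dD)"
    unfolding N_def D_def dN_def dD_def
    by (intro GDERIV_divide GDERIV_integral_gauss_kernel[OF sets_\<mu> bX \<epsilon>_pos] integrable_inverse integrable_inverse_mult \<phi>)
      (use dx in \<open>simp add: D_def\<close>)
  have dN: "(1 / \<delta> x) *\<^sub>R dN = (\<integral>y. (b x y * \<phi> y) *\<^sub>R ((2 / \<epsilon>) *\<^sub>R (y - x)) \<partial>\<mu>)"
    unfolding b\<phi> dN_def integral_scaleR_right[symmetric] by (simp add: mult.commute)
  have "(1 / \<delta> x) *\<^sub>R dD = (\<integral>y. b x y *\<^sub>R ((2 / \<epsilon>) *\<^sub>R (y - x)) \<partial>\<mu>)"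
    unfolding b_apply dD_def integral_scaleR_right[symmetric] by (simp add: mult.commute)
  \<comment> \<open>Splitting \<open>y - x\<close> uses that \<open>b x\<close> has integral 1: the
    gradient of the normalizing integral points from \<open>x\<close> to the barycentre
    \<open>m\<close>.\<close>
  also have "\<dots> = (2 / \<epsilon>) *\<^sub>R (\<integral>y. b x y *\<^sub>R y - b x y *\<^sub>R x \<partial>\<mu>)"
    unfolding integral_scaleR_right[symmetric] by (simp add: scaleR_diff_right mult.commute)
  also have "(\<integral>y. b x y *\<^sub>R y - b x y *\<^sub>R x \<partial>\<mu>) = m - x"
    using integrable_scaleR_bounded[OF sets_\<mu> bX integrable_b[OF x]] integrable_b[OF x] integral_b[OF x]
    by (simp add: m_def)
  finally have dD: "(1 / \<delta> x) *\<^sub>R dD = (2 / \<epsilon>) *\<^sub>R (m - x)" .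
  have "(1 / D x) *\<^sub>R (dN - (N x / D x) *\<^sub>R dD) = (1 / \<delta> x) *\<^sub>R dN - (N x / D x) *\<^sub>R ((1 / \<delta> x) *\<^sub>R dD)"
    by (simp add: dx(2) scaleR_diff_right)
  \<comment> \<open>As \<open>N x / D x\<close> is the integral of \<open>b x y * \<phi> y\<close>,
    the constant vector joins the integrand; subtracting \<open>m - x\<close> from
    \<open>y - x\<close> then cancels \<open>x\<close> and leaves \<open>y - m\<close>.\<close>
  also have "\<dots> = (\<integral>y. (b x y * \<phi> y) *\<^sub>R ((2 / \<epsilon>) *\<^sub>R (y - x)) \<partial>\<mu>) - (\<integral>y. (b x y * \<phi> y) *\<^sub>R ((2 / \<epsilon>) *\<^sub>R (m - x)) \<partial>\<mu>)"
    unfolding dN dD Nx by (simp add: integral_scaleR_left ib\<phi>)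
  also have "\<dots> = (\<integral>y. (b x y * \<phi> y) *\<^sub>R ((2 / \<epsilon>) *\<^sub>R (y - x)) - (b x y * \<phi> y) *\<^sub>R ((2 / \<epsilon>) *\<^sub>R (m - x)) \<partial>\<mu>)"
    by (intro Bochner_Integration.integral_diff[symmetric] integrable_scaleR_left ib\<phi>
        integrable_scaleR_diff_bounded[OF sets_\<mu> bX])
  also have "\<dots> = (\<integral>y. (b x y * \<phi> y) *\<^sub>R ((2 / \<epsilon>) *\<^sub>R (y - m)) \<partial>\<mu>)"
    by (simp add: scaleR_diff_right[symmetric])
  finally have "GDERIV (\<lambda>x. N x / D x) x :> (\<integral>y. (b x y * \<phi> y) *\<^sub>R ((2 / \<epsilon>) *\<^sub>R (y - m)) \<partial>\<mu>)"
    using der by simp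
  from GDERIV_mult[OF GDERIV_const[of "1 / ev"] this]
  have "GDERIV (\<lambda>x. 1 / ev * (N x / D x)) x :> (1 / ev) *\<^sub>R (\<integral>y. (b x y * \<phi> y) *\<^sub>R ((2 / \<epsilon>) *\<^sub>R (y - m)) \<partial>\<mu>)"
    by simp
  then show ?thesis unfolding N_def D_def m_def nystrom_extension_eq[symmetric] by simp
qed

lemma nystrom_extension_AE_eq:
  assumes "L2_eigenfunction \<mu> b ev \<phi>" "ev \<noteq> 0"
  shows "AE x in \<mu>. nystrom_extension \<mu> (gauss_kernel \<epsilon>) \<delta> ev \<phi> x = \<phi> x"
proof -
  have "AE x in \<mu>. kernel_operator \<mu> b \<phi> x = ev * \<phi> x"
    using assms(1) by (simp add: L2_eigenfunction_def)
  with AE_space show ?thesis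
  proof eventually_elim
    case (elim x)
    then show ?case using assms(2)
      by (simp add: nystrom_extension_def kernel_operator_def extended_kernel_eq space_\<mu>)
  qed
qed

end

section \<open>From ambient gradients to Riemannian gradients of continuous representatives\<close>

text \<open>If the weighted measure of \<open>A\<close> vanished, \<open>f\<close> would be 0 almost
  everywhere on \<open>A\<close>; being positive, it would make \<open>A\<close> a null set.\<close>

lemma density_emeasure_pos:
  assumes "f \<in> borel_measurable M" "\<And>x. x \<in> space M \<Longrightarrow> f x > 0" "A \<in> sets M" "emeasure M A > 0"
  shows "emeasure (density M f) A > 0"
proof (rule ccontr)
  assume "\<not> ?thesis"
  then have "AE x in M. x \<in> A \<longrightarrow> f x = 0"
    using null_sets_density_iff[OF assms(1), of A] assms(3) by (auto simp: null_sets_def)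
  with AE_space have "AE x in M. x \<notin> A"
    by eventually_elim (use assms(2) in fastforce)
  then have "A \<in> null_sets M" using assms(3) AE_iff_null_sets by blast
  then show False using assms(4) by auto
qed

text \<open>A curve in \<open>X\<close> sees \<open>F\<close> only through its values on
  \<open>X\<close>, so the chain rule for \<open>F\<close> differentiates \<open>f\<close> along the
  curve; projecting \<open>g\<close> makes it tangent and keeps its products with
  velocities.\<close>

lemma riemannian_gradient_restrict:
  fixes X :: "(real^'d) set"
  assumes "smooth_submanifold TYPE('m::finite) X" "x \<in> X"
    and "GDERIV F x :> g" "\<And>y. y \<in> X \<Longrightarrow> F y = f y"
  shows "riemannian_gradient X f x (closest_point (tangent_space X x) g)"
proof -
  let ?T = "tangent_space X x"
  have T: "subspace ?T" using subspace_tangent_space assms(1,2) by blast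
  have "(f \<circ> \<gamma> has_real_derivative closest_point ?T g \<bullet> v) (at 0)" if c: "curve_through X x v \<gamma>" for v \<gamma>
  proof -
    obtain e where e: "e > 0" "\<gamma> ` {-e<..<e} \<subseteq> X" and \<gamma>: "\<gamma> 0 = x" "(\<gamma> has_vector_derivative v) (at 0)"
      using c unfolding curve_through_def by blast
    have "v \<in> ?T" using c unfolding tangent_space_def by blast
    then have P: "closest_point ?T g \<bullet> v = g \<bullet> v" by (rule closest_point_subspace_inner[OF T])
    have "(F has_derivative (\<lambda>h. h \<bullet> g)) (at (\<gamma> 0))" using assms(3) \<gamma>(1) by (simp add: gderiv_def)
    then have "((\<lambda>t. F (\<gamma> t)) has_derivative (\<lambda>s. (s *\<^sub>R v) \<bullet> g)) (at 0)"
      using \<gamma>(2) unfolding has_vector_derivative_def by (rule has_derivative_compose[rotated])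
    then have "((\<lambda>t. F (\<gamma> t)) has_real_derivative g \<bullet> v) (at 0)"
      unfolding has_field_derivative_def
      by (rule has_derivative_eq_rhs) (simp add: inner_commute mult.commute fun_eq_iff)
    then have "(f \<circ> \<gamma> has_real_derivative g \<bullet> v) (at 0)"
      by (rule has_field_derivative_transform_within_open[of _ _ _ "{-e<..<e}"])
        (use e assms(4) in \<open>auto simp: image_subset_iff\<close>)
    then show ?thesis by (simp add: P)
  qed
  moreover have "closest_point ?T g \<in> ?T"
    using T subspace_0 by (intro closest_point_in_set closed_subspace) auto
  ultimately show ?thesis unfolding riemannian_gradient_def by blast
qed

theorem proposition1:
  fixes X :: "(real^'d) set"
    and vol \<mu> :: "(real^'d) measure"
    and q w \<delta> \<phi> :: "real^'d \<Rightarrow> real"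
    and \<epsilon> ev :: real
    and b :: "real^'d \<Rightarrow> real^'d \<Rightarrow> real"
    and xbar G :: "real^'d \<Rightarrow> real^'d"
  assumes "compact X"
    and "smooth_submanifold TYPE('m::finite) X"
    and "riemannian_volume TYPE('m) X vol"
    and "Ck_manifold TYPE('m) 3 X q" and "\<forall>x\<in>X. q x > 0"
    and "Ck_manifold TYPE('m) 3 X w" and "\<forall>x\<in>X. w x > 0"
    and "\<epsilon> > 0"
    and "\<mu> = density vol (\<lambda>x. ennreal (q x / w x))"
    and "smooth_manifold_fun TYPE('m) X \<delta>" and "\<forall>x\<in>X. \<delta> x > 0"
    and "b = normalized_kernel (gauss_kernel \<epsilon>) \<delta>"
    and "bistochastic \<mu> b"
    and "L2_eigenfunction \<mu> b ev \<phi>" and "ev \<noteq> 0"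
    and "xbar = (\<lambda>x. \<integral>y. b x y *\<^sub>R y \<partial>\<mu>)"
    and "G = (\<lambda>x. (1 / ev) *\<^sub>R
                 (\<integral>y. (b x y * \<phi> y) *\<^sub>R ((2 / \<epsilon>) *\<^sub>R (y - xbar x)) \<partial>\<mu>))"
  shows "(\<forall>x\<in>X. GDERIV (nystrom_extension \<mu> (gauss_kernel \<epsilon>) \<delta> ev \<phi>) x :> G x) \<and>
         (AE x in \<mu>. nystrom_extension \<mu> (gauss_kernel \<epsilon>) \<delta> ev \<phi> x = \<phi> x) \<and>
         (\<forall>f. continuous_on X f \<and> (AE x in \<mu>. f x = \<phi> x) \<longrightarrow>
            (\<forall>x\<in>X. nystrom_extension \<mu> (gauss_kernel \<epsilon>) \<delta> ev \<phi> x = f x \<and>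
               riemannian_gradient X f x
                 (closest_point (tangent_space X x) (G x))))"
proof -
  note compact_X = assms(1) and submanifold = assms(2) and volume = assms(3)
    and \<mu>_def = assms(9) and eigen = assms(14,15)
  have sets_vol: "sets vol = sets (restrict_space borel X)"
    using volume by (simp add: riemannian_volume_def)
  have sets_\<mu>: "sets \<mu> = sets (restrict_space borel X)" by (simp add: \<mu>_def sets_vol)
  have \<delta>_continuous: "continuous_on X \<delta>"
    using assms(10) unfolding smooth_manifold_fun_def
    by (blast intro: Ck_manifold_imp_continuous_on[OF submanifold])
  interpret gaussian_bistochastic X \<mu> \<delta> \<epsilon> b
  proof (rule gaussian_bistochastic.intro)
    show "\<delta> x > 0" if "x \<in> X" for x using assms(11) that by blast
  qed (fact compact_X sets_\<mu> \<delta>_continuous assms(8,12,13))+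
  let ?F = "nystrom_extension \<mu> (gauss_kernel \<epsilon>) \<delta> ev \<phi>"
  have "integrable \<mu> \<phi>"
    using eigen(1) unfolding L2_eigenfunction_def by (elim conjE) (rule integrable_of_square_integrable)
  then have grad: "GDERIV ?F x :> G x" if "x \<in> X" for x
    using GDERIV_nystrom_extension that assms(16,17) by simp
  have ae: "AE x in \<mu>. ?F x = \<phi> x" by (rule nystrom_extension_AE_eq[OF eigen])
  \<comment> \<open>The weight is measurable and positive, so \<open>\<mu>\<close> inherits from
    \<open>vol\<close> that nonempty relatively open sets have positive measure.\<close>
  have "continuous_on X (\<lambda>x. q x / w x)"
    using assms(7) Ck_manifold_imp_continuous_on[OF submanifold] assms(4,6)
    by (intro continuous_intros) (blast, blast, fastforce)
  then have "(\<lambda>x. ennreal (q x / w x)) \<in> borel_measurable vol"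
    using borel_measurable_continuous_on_space[OF sets_vol] by measurable
  moreover have "ennreal (q x / w x) > 0" if "x \<in> space vol" for x
    using that assms(5,7) space_eq_if_sets_restrict_borel[OF sets_vol] by simp
  ultimately have pos: "emeasure \<mu> A > 0" if "openin (top_of_set X) A" "A \<noteq> {}" for A
    unfolding \<mu>_def
    using riemannian_volume_openin_pos[OF submanifold volume that] openin_in_sets[OF sets_vol that(1)]
    by (intro density_emeasure_pos)
  have F_continuous: "continuous_on X ?F"
    using grad unfolding gderiv_def
    by (auto intro!: continuous_at_imp_continuous_on has_derivative_continuous)
  have F_eq: "?F x = f x" if "continuous_on X f" "AE x in \<mu>. f x = \<phi> x" "x \<in> X" for f x
  proof (rule continuous_AE_eq_imp_eq[OF pos sets_\<mu> F_continuous that(1) _ that(3)])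
    show "AE x in \<mu>. ?F x = f x" using ae that(2) by eventually_elim simp
  qed
  show ?thesis
  proof (intro conjI allI impI ballI)
    fix f x assume f: "continuous_on X f \<and> (AE x in \<mu>. f x = \<phi> x)" and x: "x \<in> X"
    \<comment> \<open>Equality on all of \<open>X\<close>, and not just at \<open>x\<close>, is what
      allows differentiation along curves.\<close>
    have eq: "?F y = f y" if "y \<in> X" for y using F_eq f that by blast
    show "?F x = f x" by (rule eq[OF x])
    show "riemannian_gradient X f x (closest_point (tangent_space X x) (G x))"
      by (rule riemannian_gradient_restrict[OF submanifold x grad[OF x] eq])
  qed (fact grad ae)+
qed

end
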